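(* For all positive integers $b,k,h$, let $p_c(b,k,h)$ be the number of corner-polyominoes inscribed in the $b\times k\times h$ rectangular prism. Then $$p_c(b,k,h)=\begin{cases}2\binom{b+k+h-3}{b-1,\,k-1,\,h-1}-1 & \text{if } b=1 \text{ or } k=1 \text{ or } h=1,\\[4pt] 1+2\binom{b+k-2}{b-1}+2\binom{b+h-2}{b-1}+2\binom{k+h-2}{k-1}-6\\ \quad +\,p_c(b-1,k,h)+p_c(b,k-1,h)+p_c(b,k,h-1) & \text{otherwise.}\end{cases}$$
   Context: Cells are unit cubes indexed by integer triples $(i,j,l)$; two cells are adjacent if they differ by $1$ in exactly one coordinate (i.e. they share a face). A (3D) polyomino is a finite nonempty set of cells that is connected under this adjacency. A polyomino is inscribed in the $b\times k\times h$ rectangular prism if all its cells satisfy $1\le i\le b$, $1\le j\le k$, $1\le l\le h$, and it touches each of the six faces of the prism, i.e. it contains cells with $i=1$, with $i=b$, with $j=1$, with $j=k$, with $l=1$ and with $l=h$. The minimal possible volume (number of cells) of such an inscribed polyomino is $b+k+h-2$; "minimal" polyominoes are inscribed polyominoes with exactly this number of cells. A corner-polyomino inscribed in the prism is a minimal inscribed polyomino containing the corner cell $(1,1,1)$ of the prism (by symmetry, the count does not depend on which corner is fixed). $\binom{a+b+c}{a,b,c}=\frac{(a+b+c)!}{a!\,b!\,c!}$ denotes a trinomial coefficient. *)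

theory Defs
  imports Complex_Main
begin

type_synonym cell = "int \<times> int \<times> int"

definition adjacent :: "cell \<Rightarrow> cell \<Rightarrow> bool" where
  "adjacent c d \<longleftrightarrow> (case (c, d) of ((i, j, l), (i', j', l')) \<Rightarrow>
     \<bar>i - i'\<bar> = 1 \<and> j = j' \<and> l = l' \<or>
     i = i' \<and> \<bar>j - j'\<bar> = 1 \<and> l = l' \<or>
     i = i' \<and> j = j' \<and> \<bar>l - l'\<bar> = 1)"

definition connected_cells :: "cell set \<Rightarrow> bool" where
  "connected_cells P \<longleftrightarrow>
     (\<forall>c\<in>P. \<forall>d\<in>P. (c, d) \<in> {(x, y). x \<in> P \<and> y \<in> P \<and> adjacent x y}\<^sup>*)"

definition polyomino :: "cell set \<Rightarrow> bool" where
  "polyomino P \<longleftrightarrow> finite P \<and> P \<noteq> {} \<and> connected_cells P"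

definition prism :: "nat \<Rightarrow> nat \<Rightarrow> nat \<Rightarrow> cell set" where
  "prism b k h = {1..int b} \<times> {1..int k} \<times> {1..int h}"

definition inscribed :: "nat \<Rightarrow> nat \<Rightarrow> nat \<Rightarrow> cell set \<Rightarrow> bool" where
  "inscribed b k h P \<longleftrightarrow> P \<subseteq> prism b k h \<and>
     (\<exists>(i, j, l)\<in>P. i = 1) \<and> (\<exists>(i, j, l)\<in>P. i = int b) \<and>
     (\<exists>(i, j, l)\<in>P. j = 1) \<and> (\<exists>(i, j, l)\<in>P. j = int k) \<and>
     (\<exists>(i, j, l)\<in>P. l = 1) \<and> (\<exists>(i, j, l)\<in>P. l = int h)"

text \<open>
  The least volume of a polyomino inscribed in the \<open>b \<times> k \<times> h\<close> prism is \<open>b + k + h - 2\<close>,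
  and minimality means having exactly this many cells. The subtraction on naturals is exact
  for positive \<open>b\<close>, \<open>k\<close>, \<open>h\<close>.
\<close>

definition minimal_inscribed :: "nat \<Rightarrow> nat \<Rightarrow> nat \<Rightarrow> cell set \<Rightarrow> bool" where
  "minimal_inscribed b k h P \<longleftrightarrow>
     polyomino P \<and> inscribed b k h P \<and> card P = b + k + h - 2"

definition corner_polyomino :: "nat \<Rightarrow> nat \<Rightarrow> nat \<Rightarrow> cell set \<Rightarrow> bool" where
  "corner_polyomino b k h P \<longleftrightarrow> minimal_inscribed b k h P \<and> (1, 1, 1) \<in> P"

definition p_c :: "nat \<Rightarrow> nat \<Rightarrow> nat \<Rightarrow> nat" where
  "p_c b k h = card {P. corner_polyomino b k h P}"

text \<open>Polyominoes are counted as subsets of a fixed prism, so \<open>card\<close> is applied to a finite set.\<close>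

lemma finite_corner_polyominoes: "finite {P. corner_polyomino b k h P}"
proof (rule finite_subset)
  show "{P. corner_polyomino b k h P} \<subseteq> Pow (prism b k h)"
    by (auto simp: corner_polyomino_def minimal_inscribed_def inscribed_def)
  show "finite (Pow (prism b k h))"
    by (simp add: prism_def)
qed

definition trinomial :: "nat \<Rightarrow> nat \<Rightarrow> nat \<Rightarrow> nat" where
  "trinomial a b c = fact (a + b + c) div (fact a * fact b * fact c)"

text \<open>The division on naturals is exact.\<close>

lemma trinomial_dvd: "(fact a * fact b * fact c :: nat) dvd fact (a + b + c)"
proof -
  have "(fact a * fact b * fact c :: nat) dvd fact (a + b) * fact c"
    by (intro mult_dvd_mono fact_fact_dvd_fact dvd_refl)
  also have "\<dots> dvd (fact (a + b + c) :: nat)"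
    by (rule fact_fact_dvd_fact)
  finally show ?thesis .
qed

end

theory Submission
  imports Defs
begin

text \<open>
  Adding to a set a cell adjacent to it enlarges only one of its three coordinate projections,
  and by at most one element. So a connected set \<open>P\<close> has at least
  \<open>card (xproj P) + card (yproj P) + card (zproj P) - 2\<close> cells, and the corner-polyominoes are the
  connected sets with full projections that attain this bound (``tight'' sets). Fix a neighbour of
  the corner in a tight set and cut the set at the corner into the branch through that neighbour
  and the rest. Both pieces are tight again, and each coordinate varies in at most one of
  them. Hence a corner with one neighbour can be removed, a corner with two neighbours carries a
  straight arm and a planar branch, and a corner with three neighbours carries three
  straight arms. Summing over these cases gives the recursion.
\<close>

section \<open>Connected sets and their projections\<close>

abbreviation xproj :: "cell set \<Rightarrow> int set" where "xproj P \<equiv> fst ` P"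
abbreviation yproj :: "cell set \<Rightarrow> int set" where "yproj P \<equiv> (\<lambda>c. fst (snd c)) ` P"
abbreviation zproj :: "cell set \<Rightarrow> int set" where "zproj P \<equiv> (\<lambda>c. snd (snd c)) ` P"

definition links :: "cell set \<Rightarrow> (cell \<times> cell) set" where
  "links P = {(x, y). x \<in> P \<and> y \<in> P \<and> adjacent x y}"

text \<open>Connectivity is rooted at one cell, so that facts about all of \<open>P\<close> follow
  by induction along paths leaving the corner.\<close>

definition conn_from :: "cell \<Rightarrow> cell set \<Rightarrow> bool" where
  "conn_from a P \<longleftrightarrow> a \<in> P \<and> (\<forall>x\<in>P. (a, x) \<in> (links P)\<^sup>*)"

text \<open>The equality case of the bound in \<open>card_projections_le\<close>. The
  \<open>+ 2\<close> stands on the left to avoid truncated subtraction.\<close>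

definition tight :: "cell \<Rightarrow> cell set \<Rightarrow> bool" where
  "tight a P \<longleftrightarrow> finite P \<and> conn_from a P \<and> card P + 2 = card (xproj P) + card (yproj P) + card (zproj P)"

lemma adjacent_simp [simp]:
  "adjacent (i, j, l) (i', j', l') \<longleftrightarrow>
     \<bar>i - i'\<bar> = 1 \<and> j = j' \<and> l = l' \<or> i = i' \<and> \<bar>j - j'\<bar> = 1 \<and> l = l' \<or>
     i = i' \<and> j = j' \<and> \<bar>l - l'\<bar> = 1"
  by (simp add: adjacent_def)

lemma adjacent_sym: "adjacent x y \<Longrightarrow> adjacent y x"
  by (cases x; cases y) auto

lemma conn_fromI: "a \<in> P \<Longrightarrow> (\<And>x. x \<in> P \<Longrightarrow> (a, x) \<in> (links P)\<^sup>*) \<Longrightarrow> conn_from a P"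
  by (simp add: conn_from_def)

lemma links_mono: "P \<subseteq> Q \<Longrightarrow> (a, x) \<in> (links P)\<^sup>* \<Longrightarrow> (a, x) \<in> (links Q)\<^sup>*"
  using rtrancl_mono[of "links P" "links Q"] by (auto simp: links_def)

lemma links_step:
  "(a, x) \<in> (links P)\<^sup>* \<Longrightarrow> x \<in> P \<Longrightarrow> y \<in> P \<Longrightarrow> adjacent x y \<Longrightarrow> (a, y) \<in> (links P)\<^sup>*"
  by (rule rtrancl_into_rtrancl) (auto simp: links_def)

lemma connected_cells_conn_from:
  assumes "a \<in> P"
  shows "connected_cells P \<longleftrightarrow> conn_from a P"
proof
  assume "connected_cells P"
  then show "conn_from a P"
    using assms by (auto simp: connected_cells_def conn_from_def links_def)
next
  assume c: "conn_from a P"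
  have "sym (links P)"
    by (auto simp: sym_def links_def intro: adjacent_sym)
  then have s: "sym ((links P)\<^sup>*)"
    by (rule sym_rtrancl)
  show "connected_cells P"
    unfolding connected_cells_def
  proof (intro ballI)
    fix x y assume "x \<in> P" "y \<in> P"
    then have "(a, x) \<in> (links P)\<^sup>*" "(a, y) \<in> (links P)\<^sup>*"
      using c by (auto simp: conn_from_def)
    then have "(x, y) \<in> (links P)\<^sup>*"
      using s by (meson rtrancl_trans symD)
    then show "(x, y) \<in> {(x, y). x \<in> P \<and> y \<in> P \<and> adjacent x y}\<^sup>*"
      by (simp add: links_def)
  qed
qed

text \<open>If no link left \<open>Q\<close>, every path from \<open>a\<close> would stay inside
  \<open>Q\<close>. Hence \<open>P\<close> can be built up from \<open>a\<close> one adjacent cell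
  at a time.\<close>

lemma conn_from_exit:
  assumes "conn_from a P" "a \<in> Q" "Q \<subseteq> P" "Q \<noteq> P"
  obtains x y where "x \<in> Q" "y \<in> P - Q" "adjacent x y"
proof -
  have "\<exists>x\<in>Q. \<exists>y\<in>P - Q. adjacent x y"
  proof (rule ccontr)
    assume n: "\<not> ?thesis"
    have "x \<in> Q" if "(a, x) \<in> (links P)\<^sup>*" for x
      using that by induction (use assms n in \<open>auto simp: links_def\<close>)
    then show False
      using assms by (auto simp: conn_from_def)
  qed
  then show ?thesis using that by blast
qed

lemma conn_from_no_neighbour:
  assumes "conn_from a P" "\<And>x. x \<in> P \<Longrightarrow> \<not> adjacent a x"
  shows "P = {a}"
proof (rule ccontr)
  assume "P \<noteq> {a}"
  then obtain x y where "x \<in> {a}" "y \<in> P - {a}" "adjacent x y"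
    using conn_from_exit[of a P "{a}"] assms by (auto simp: conn_from_def)
  then show False using assms by auto
qed

lemma card_insert_le_Suc: "card (insert x S) \<le> Suc (card S)"
  by (rule card_insert_le_m1[THEN order_trans]) auto

text \<open>Grow a subset from \<open>{a}\<close> to all of \<open>P\<close> by adjacent cells. At
  the start the projections have total size 3 = 1 + 2, and each new cell adds at most 1 to the
  total.\<close>

lemma card_projections_le:
  assumes "finite P" "conn_from a P"
  shows "card (xproj P) + card (yproj P) + card (zproj P) \<le> card P + 2"
proof -
  have a: "a \<in> P" using assms by (simp add: conn_from_def)
  have *: "\<exists>Q\<subseteq>P. a \<in> Q \<and> card Q = Suc n \<and> card (xproj Q) + card (yproj Q) + card (zproj Q) \<le> card Q + 2"
    if "Suc n \<le> card P" for n
    using that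
  proof (induction n)
    case 0
    show ?case by (rule exI[of _ "{a}"]) (use a in auto)
  next
    case (Suc n)
    then obtain Q where Q: "Q \<subseteq> P" "a \<in> Q" "card Q = Suc n"
      "card (xproj Q) + card (yproj Q) + card (zproj Q) \<le> card Q + 2"
      by (meson Suc_leD)
    have fQ: "finite Q" using Q assms finite_subset by blast
    have "Q \<noteq> P" using Q Suc.prems by auto
    then obtain x y where xy: "x \<in> Q" "y \<in> P - Q" "adjacent x y"
      using conn_from_exit[OF assms(2) Q(2,1)] by blast
    obtain i j l where x: "x = (i, j, l)" by (cases x)
    obtain i' j' l' where y: "y = (i', j', l')" by (cases y)
    have im: "i \<in> xproj Q" "j \<in> yproj Q" "l \<in> zproj Q"
      using imageI[OF xy(1), of fst] imageI[OF xy(1), of "\<lambda>c. fst (snd c)"]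
        imageI[OF xy(1), of "\<lambda>c. snd (snd c)"] by (simp_all add: x)
    have c: "card (insert y Q) = Suc (Suc n)" using Q xy fQ by auto
    have "card (insert i' (xproj Q)) + card (insert j' (yproj Q)) + card (insert l' (zproj Q))
       \<le> Suc (card (xproj Q) + card (yproj Q) + card (zproj Q))"
    proof -
      \<comment> \<open>Two coordinates of \<open>y\<close> already occur at \<open>x\<close>, so
        two of the three insertions are void.\<close>
      have "i' = i \<and> j' = j \<or> i' = i \<and> l' = l \<or> j' = j \<and> l' = l"
        using xy(3) unfolding x y adjacent_simp by blast
      then show ?thesis
        using im card_insert_le_Suc[of i' "xproj Q"] card_insert_le_Suc[of j' "yproj Q"]
          card_insert_le_Suc[of l' "zproj Q"]
        by (elim disjE conjE) (simp_all add: insert_absorb)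
    qed
    then have "card (xproj (insert y Q)) + card (yproj (insert y Q)) + card (zproj (insert y Q))
        \<le> card (insert y Q) + 2"
      using Q(3,4) c by (simp add: y)
    then show ?case
      using Q(1,2) xy(2) c by (intro exI[of _ "insert y Q"]) blast
  qed
  obtain Q where "Q \<subseteq> P" "card Q = card P"
      "card (xproj Q) + card (yproj Q) + card (zproj Q) \<le> card Q + 2"
  proof -
    have "Suc (card P - 1) = card P" using assms(1) a by (metis Suc_pred' card_gt_0_iff empty_iff)
    then show ?thesis using *[of "card P - 1"] that by force
  qed
  moreover from this have "Q = P" using assms(1) card_subset_eq by blast
  ultimately show ?thesis by simp
qed

text \<open>A discrete intermediate value argument: one step changes each coordinate by at most one,
  so a path rising from the root to level \<open>x\<close> visits all levels in between. For
  \<open>x < p\<close> the interval is empty.\<close>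

lemma conn_from_interval:
  assumes "conn_from (p, q, r) P"
  shows "x \<in> xproj P \<Longrightarrow> {p..x} \<subseteq> xproj P" "y \<in> yproj P \<Longrightarrow> {q..y} \<subseteq> yproj P"
    "z \<in> zproj P \<Longrightarrow> {r..z} \<subseteq> zproj P"
proof -
  have o: "(p, q, r) \<in> P" using assms by (simp add: conn_from_def)
  have *: "{p..fst c} \<subseteq> xproj P \<and> {q..fst (snd c)} \<subseteq> yproj P \<and> {r..snd (snd c)} \<subseteq> zproj P"
    if "((p, q, r), c) \<in> (links P)\<^sup>*" for c
    using that
  proof induction
    case base
    show ?case using o by force
  next
    case (step c d)
    obtain i j l where c: "c = (i, j, l)" by (cases c)
    obtain i' j' l' where d: "d = (i', j', l')" by (cases d)
    have im: "i' \<in> xproj P" "j' \<in> yproj P" "l' \<in> zproj P" and ad: "adjacent c d"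
      using step(2) unfolding links_def d by force+
    have "i' \<le> i + 1" "j' \<le> j + 1" "l' \<le> l + 1"
      using ad unfolding c d by auto
    then have "{p..i'} \<subseteq> insert i' {p..i}" "{q..j'} \<subseteq> insert j' {q..j}"
       "{r..l'} \<subseteq> insert l' {r..l}"
      by auto
    then show ?case
      using step.IH im unfolding c d fst_conv snd_conv by blast
  qed
  show "x \<in> xproj P \<Longrightarrow> {p..x} \<subseteq> xproj P" "y \<in> yproj P \<Longrightarrow> {q..y} \<subseteq> yproj P"
    "z \<in> zproj P \<Longrightarrow> {r..z} \<subseteq> zproj P"
    using * assms unfolding conn_from_def by blast+
qed

text \<open>Two such sets that both go beyond \<open>p\<close> share \<open>p + 1\<close> as well as
  \<open>p\<close>. This turns an overlap of size one into the fact that a coordinate is constant on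
  one of two pieces.\<close>

lemma int_interval_inter:
  fixes p :: int
  assumes "\<And>x. x \<in> X \<Longrightarrow> {p..x} \<subseteq> X" "\<And>x. x \<in> Y \<Longrightarrow> {p..x} \<subseteq> Y"
    "X \<subseteq> {p..}" "Y \<subseteq> {p..}" "p \<in> X" "p \<in> Y" "card (X \<inter> Y) = 1"
  shows "X = {p} \<or> Y = {p}"
proof (rule ccontr)
  assume "\<not> ?thesis"
  then obtain x y where "x \<in> X" "x \<noteq> p" "y \<in> Y" "y \<noteq> p"
    using assms by blast
  then have "p + 1 \<in> X \<inter> Y"
    using assms(1)[of x] assms(2)[of y] assms(3,4) by force
  moreover have "p \<in> X \<inter> Y" using assms by blast
  ultimately show False
    using assms(7) by (metis card_1_singletonE singletonD less_add_one less_irrefl)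
qed

section \<open>Cutting a tight set at its corner\<close>

definition octant :: "cell \<Rightarrow> cell set" where
  "octant a = {c. fst a \<le> fst c \<and> fst (snd a) \<le> fst (snd c) \<and> snd (snd a) \<le> snd (snd c)}"

lemma octant_neighbour:
  assumes "c \<in> octant (p, q, r)" "adjacent (p, q, r) c"
  shows "c = (p + 1, q, r) \<or> c = (p, q + 1, r) \<or> c = (p, q, r + 1)"
  using assms by (cases c) (auto simp: octant_def)

lemma conn_from_insert:
  assumes "conn_from n K" "adjacent a n"
  shows "conn_from a (insert a K)"
proof (rule conn_fromI)
  fix x assume x: "x \<in> insert a K"
  have n: "n \<in> K" using assms by (simp add: conn_from_def)
  show "(a, x) \<in> (links (insert a K))\<^sup>*"
  proof (cases "x = a")
    case False
    then have "(n, x) \<in> (links (insert a K))\<^sup>*"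
      using assms x links_mono[OF subset_insertI] unfolding conn_from_def by blast
    moreover have "(a, n) \<in> links (insert a K)" using n assms by (auto simp: links_def)
    ultimately show ?thesis by (rule converse_rtrancl_into_rtrancl[rotated])
  qed simp
qed simp

text \<open>Delete \<open>a\<close> and take for \<open>A\<close> the component of \<open>n\<close>
  in what remains. The cell \<open>a\<close> is kept on both sides of the cut as the hinge.\<close>

lemma component_conn_from:
  assumes "conn_from a P" "n \<in> P" "adjacent a n" "a \<noteq> n"
  obtains A where "n \<in> A" "A \<subseteq> P - {a}" "conn_from n A" "conn_from a (insert a A)" "conn_from a (P - A)"
proof
  define A where "A = {x. (n, x) \<in> (links (P - {a}))\<^sup>*}"
  show nA: "n \<in> A" by (simp add: A_def)
  have "x \<in> P - {a}" if "(n, x) \<in> (links (P - {a}))\<^sup>*" for x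
    using that by induction (use assms in \<open>auto simp: links_def\<close>)
  then show AP: "A \<subseteq> P - {a}" by (auto simp: A_def)
  have cA: "(n, x) \<in> (links A)\<^sup>*" if "(n, x) \<in> (links (P - {a}))\<^sup>*" for x
    using that
  proof induction
    case (step y z)
    then have "y \<in> A" "z \<in> A" "adjacent y z"
      by (auto simp: A_def links_def intro: rtrancl_into_rtrancl)
    then show ?case using step.IH by (rule links_step[rotated])
  qed simp
  then show cnA: "conn_from n A"
    using nA by (auto simp: conn_from_def A_def)
  show "conn_from a (insert a A)"
    using cnA assms(3) by (rule conn_from_insert)
  \<comment> \<open>A cell outside \<open>A\<close> is reached without entering \<open>A\<close>: a
    step from \<open>A\<close> to a cell other than \<open>a\<close> stays in the component, and at
    \<open>a\<close> the path may restart.\<close>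
  have *: "x \<in> A \<or> x \<in> P - A \<and> (a, x) \<in> (links (P - A))\<^sup>*" if "(a, x) \<in> (links P)\<^sup>*" for x
    using that
  proof induction
    case base
    then show ?case using assms AP by (auto simp: conn_from_def)
  next
    case (step y z)
    have yz: "y \<in> P" "z \<in> P" "adjacent y z" using step by (auto simp: links_def)
    show ?case
    proof (cases "z \<in> A \<or> z = a")
      case True
      then show ?thesis using assms AP by (auto simp: conn_from_def)
    next
      case False
      have "y \<notin> A"
      proof
        assume y: "y \<in> A"
        then have "(y, z) \<in> links (P - {a})"
          using False yz AP by (auto simp: links_def)
        then have "z \<in> A" using y by (auto simp: A_def)
        then show False using False by simp
      qed
      then show ?thesis using step.IH False yz links_step[of a y "P - A" z] by auto
    qed
  qed
  show "conn_from a (P - A)"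
    using * assms(1) AP unfolding conn_from_def by blast
qed

text \<open>Let \<open>B\<close> be the branch \<open>A\<close> with the corner and \<open>C\<close>
  the rest. They share only the corner, so \<open>card P + 1 = card B + card C\<close>, while their
  projections overlap at least in the coordinates of the corner. Adding the bounds of
  \<open>card_projections_le\<close> for \<open>B\<close> and \<open>C\<close> leaves no slack: both
  are tight, and every overlap has size exactly one.\<close>

lemma tight_split:
  assumes t: "tight (p, q, r) P" and oct: "P \<subseteq> octant (p, q, r)"
    and n: "n \<in> P" "adjacent (p, q, r) n"
  obtains A where "n \<in> A" "A \<subseteq> P - {(p, q, r)}" "conn_from n A"
    "tight (p, q, r) (insert (p, q, r) A)" "tight (p, q, r) (P - A)"
    "\<forall>m\<in>A. adjacent (p, q, r) m \<longrightarrow> m = n"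
    "xproj (insert (p, q, r) A) = {p} \<or> xproj (P - A) = {p}"
    "yproj (insert (p, q, r) A) = {q} \<or> yproj (P - A) = {q}"
    "zproj (insert (p, q, r) A) = {r} \<or> zproj (P - A) = {r}"
proof -
  let ?o = "(p, q, r)"
  have ne: "?o \<noteq> n" using n by (cases n) auto
  have fin: "finite P" and cP: "conn_from ?o P"
    and eq: "card P + 2 = card (xproj P) + card (yproj P) + card (zproj P)"
    using t by (auto simp: tight_def)
  obtain A where A: "n \<in> A" "A \<subseteq> P - {?o}" "conn_from n A" "conn_from ?o (insert ?o A)" "conn_from ?o (P - A)"
    using component_conn_from[OF cP n ne] by blast
  let ?B = "insert ?o A" and ?C = "P - A"
  have o: "?o \<in> P" "?o \<in> ?B" "?o \<in> ?C" using cP A by (auto simp: conn_from_def)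
  have fA: "finite A" "finite ?B" "finite ?C" using fin A finite_subset by auto
  have un: "P = ?B \<union> ?C" using o A by auto
  have "card P = card A + card ?C"
    using card_Diff_subset[of A P] card_mono[of P A] fA(1) fin A(2) by fastforce
  moreover have cB: "card ?B = card A + 1"
    using fA A by (subst card_insert_disjoint) auto
  ultimately have cardP: "card P + 1 = card ?B + card ?C" by simp
  have bB: "card (xproj ?B) + card (yproj ?B) + card (zproj ?B) \<le> card ?B + 2"
    and bC: "card (xproj ?C) + card (yproj ?C) + card (zproj ?C) \<le> card ?C + 2"
    by (rule card_projections_le; use fA A in blast)+
  have im: "card (f ` ?B) + card (f ` ?C) = card (f ` P) + card (f ` ?B \<inter> f ` ?C)
        \<and> 1 \<le> card (f ` ?B \<inter> f ` ?C)" for f :: "cell \<Rightarrow> int"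
  proof -
    have "f ` P = f ` ?B \<union> f ` ?C" using un by (metis image_Un)
    moreover have "f ?o \<in> f ` ?B \<inter> f ` ?C" using o by blast
    moreover have "finite (f ` ?B)" "finite (f ` ?C)" using fA by auto
    ultimately show ?thesis
      by (metis card_Un_Int card_gt_0_iff empty_iff finite_Int One_nat_def Suc_leI)
  qed
  have ones: "card (xproj ?B \<inter> xproj ?C) = 1" "card (yproj ?B \<inter> yproj ?C) = 1" "card (zproj ?B \<inter> zproj ?C) = 1"
    and tB: "card ?B + 2 = card (xproj ?B) + card (yproj ?B) + card (zproj ?B)"
    and tC: "card ?C + 2 = card (xproj ?C) + card (yproj ?C) + card (zproj ?C)"
    using im[of fst] im[of "\<lambda>c. fst (snd c)"] im[of "\<lambda>c. snd (snd c)"] bB bC eq cardP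
    by linarith+
  have sub: "?B \<subseteq> octant ?o" "?C \<subseteq> octant ?o" using oct A o by auto
  have low: "xproj Q \<subseteq> {p..}" "yproj Q \<subseteq> {q..}" "zproj Q \<subseteq> {r..}" if "Q \<subseteq> octant ?o" for Q
    using that by (auto simp: octant_def subset_iff)
  have root: "p \<in> xproj Q" "q \<in> yproj Q" "r \<in> zproj Q" if "?o \<in> Q" for Q
    using imageI[OF that, of fst] imageI[OF that, of "\<lambda>c. fst (snd c)"]
      imageI[OF that, of "\<lambda>c. snd (snd c)"] by simp_all
  show thesis
  proof
    show "n \<in> A" "A \<subseteq> P - {?o}" "conn_from n A" by (fact A)+
    show "tight ?o ?B" "tight ?o ?C"
      unfolding tight_def using fA A tB tC by blast+
    show "xproj ?B = {p} \<or> xproj ?C = {p}"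
      by (rule int_interval_inter[OF conn_from_interval(1)[OF A(4)] conn_from_interval(1)[OF A(5)]
            low(1)[OF sub(1)] low(1)[OF sub(2)] root(1)[OF o(2)] root(1)[OF o(3)] ones(1)])
    show "yproj ?B = {q} \<or> yproj ?C = {q}"
      by (rule int_interval_inter[OF conn_from_interval(2)[OF A(4)] conn_from_interval(2)[OF A(5)]
            low(2)[OF sub(1)] low(2)[OF sub(2)] root(2)[OF o(2)] root(2)[OF o(3)] ones(2)])
    show "zproj ?B = {r} \<or> zproj ?C = {r}"
      by (rule int_interval_inter[OF conn_from_interval(3)[OF A(4)] conn_from_interval(3)[OF A(5)]
            low(3)[OF sub(1)] low(3)[OF sub(2)] root(3)[OF o(2)] root(3)[OF o(3)] ones(3)])
    \<comment> \<open>A second neighbour of the corner in \<open>A\<close> would put all three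
      corner coordinates into the projections of \<open>A\<close>. Adding the corner would then
      raise the cardinality but no projection, so tightness of \<open>?B\<close> would make
      \<open>A\<close> violate the bound.\<close>
    show "\<forall>m\<in>A. adjacent ?o m \<longrightarrow> m = n"
    proof (rule ccontr)
      assume "\<not> ?thesis"
      then obtain m where m: "m \<in> A" "adjacent ?o m" "m \<noteq> n" by blast
      have "m = (p+1,q,r) \<or> m = (p,q+1,r) \<or> m = (p,q,r+1)"
        "n = (p+1,q,r) \<or> n = (p,q+1,r) \<or> n = (p,q,r+1)"
        using octant_neighbour m(1,2) n oct A(2) by blast+
      then have "p \<in> xproj A" "q \<in> yproj A" "r \<in> zproj A"
        using m(1,3) A(1) by force+
      then have "xproj ?B = xproj A" "yproj ?B = yproj A" "zproj ?B = zproj A"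
        by auto
      then have "card (xproj ?B) = card (xproj A)" "card (yproj ?B) = card (yproj A)"
        "card (zproj ?B) = card (zproj A)"
        by (simp_all only:)
      moreover have "card (xproj A) + card (yproj A) + card (zproj A) \<le> card A + 2"
        by (rule card_projections_le) (use fA A in auto)
      ultimately show False using tB cB by linarith
    qed
  qed
qed

section \<open>Tight sets with prescribed projections, sorted by the neighbours of the
  corner\<close>

definition tight_sets :: "int \<Rightarrow> int \<Rightarrow> int \<Rightarrow> int \<Rightarrow> int \<Rightarrow> int \<Rightarrow> cell set set" where
  "tight_sets p q r u v w =
     {P. tight (p, q, r) P \<and> xproj P = {p..u} \<and> yproj P = {q..v} \<and> zproj P = {r..w}}"

text \<open>In an octant the corner has only these three possible neighbours. With one flag for
  each, the coordinate symmetries merely permute the arguments.\<close>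

definition branch_sets :: "int \<Rightarrow> int \<Rightarrow> int \<Rightarrow> int \<Rightarrow> int \<Rightarrow> int \<Rightarrow> bool \<Rightarrow> bool \<Rightarrow> bool \<Rightarrow> cell set set" where
  "branch_sets p q r u v w a b c =
     {P \<in> tight_sets p q r u v w. ((p + 1, q, r) \<in> P) = a \<and> ((p, q + 1, r) \<in> P) = b \<and> ((p, q, r + 1) \<in> P) = c}"

lemma tight_sets_box:
  assumes "P \<in> tight_sets p q r u v w" "c \<in> P"
  shows "p \<le> fst c" "fst c \<le> u" "q \<le> fst (snd c)" "fst (snd c) \<le> v"
    "r \<le> snd (snd c)" "snd (snd c) \<le> w"
proof -
  have "fst c \<in> {p..u}" "fst (snd c) \<in> {q..v}" "snd (snd c) \<in> {r..w}"
    using assms by (auto simp: tight_sets_def)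
  then show "p \<le> fst c" "fst c \<le> u" "q \<le> fst (snd c)" "fst (snd c) \<le> v"
    "r \<le> snd (snd c)" "snd (snd c) \<le> w" by auto
qed

lemma tight_sets_octant: "P \<in> tight_sets p q r u v w \<Longrightarrow> P \<subseteq> octant (p, q, r)"
  using tight_sets_box by (fastforce simp: octant_def)

lemma tight_sets_root: "P \<in> tight_sets p q r u v w \<Longrightarrow> (p, q, r) \<in> P"
  by (auto simp: tight_sets_def tight_def conn_from_def)

lemma finite_tight_sets: "finite (tight_sets p q r u v w)"
proof (rule finite_subset)
  show "tight_sets p q r u v w \<subseteq> Pow ({p..u} \<times> {q..v} \<times> {r..w})"
    using tight_sets_box by (auto simp: subset_iff mem_Times_iff)
qed simp

lemma finite_branch_sets: "finite (branch_sets p q r u v w a b c)"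
  using finite_tight_sets by (simp add: branch_sets_def)

text \<open>Cutting at the only neighbour leaves the corner alone on the other side, so the branch
  is \<open>P\<close> without its corner. The neighbour shares y and z with the corner, which
  preserves these two projections.\<close>

lemma tight_strip:
  assumes t: "tight (p, q, r) P" and oct: "P \<subseteq> octant (p, q, r)"
    and n: "(p + 1, q, r) \<in> P" "(p, q + 1, r) \<notin> P" "(p, q, r + 1) \<notin> P"
  shows "tight (p + 1, q, r) (P - {(p, q, r)})" "xproj (P - {(p, q, r)}) = xproj P - {p}"
    "yproj (P - {(p, q, r)}) = yproj P" "zproj (P - {(p, q, r)}) = zproj P"
proof -
  let ?o = "(p, q, r)" and ?n = "(p + 1, q, r)"
  obtain A where A: "?n \<in> A" "A \<subseteq> P - {?o}" "conn_from ?n A" "tight ?o (P - A)"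
  proof (rule tight_split[OF t oct n(1)])
    show "adjacent ?o ?n" by simp
  qed
  have "P - A = {?o}"
  proof (rule conn_from_no_neighbour)
    show "conn_from ?o (P - A)" using A by (simp add: tight_def)
    show "\<not> adjacent ?o x" if "x \<in> P - A" for x
      using octant_neighbour[of x p q r] that n oct A(1) by blast
  qed
  then have AP: "A = P - {?o}" and P: "P = insert ?o A" using A(2) by blast+
  have fin: "finite A" using t AP by (simp add: tight_def)
  have im: "xproj P = insert p (xproj A)" "yproj P = yproj A" "zproj P = zproj A"
    unfolding P using imageI[OF A(1), of "\<lambda>c. fst (snd c)"] imageI[OF A(1), of "\<lambda>c. snd (snd c)"]
    by (simp_all add: insert_absorb)
  have "?o \<notin> A" using AP by blast
  then have cP: "card P = card A + 1" using fin by (simp add: P)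
  have b: "card (xproj A) + card (yproj A) + card (zproj A) \<le> card A + 2"
    by (rule card_projections_le) (use fin A in auto)
  have t': "card P + 2 = card (insert p (xproj A)) + card (yproj A) + card (zproj A)"
    using t im by (simp add: tight_def)
  \<comment> \<open>If level \<open>p\<close> survived, deleting the corner would shrink no
    projection, and the bound for \<open>A\<close> would fail.\<close>
  have p: "p \<notin> xproj A"
  proof
    assume "p \<in> xproj A"
    then have "insert p (xproj A) = xproj A" by auto
    then show False using t' b cP by simp
  qed
  then have "card (insert p (xproj A)) = card (xproj A) + 1" using fin by simp
  then have "tight ?n A" using A(3) fin t' cP by (simp add: tight_def)
  then show "tight ?n (P - {?o})" "xproj (P - {?o}) = xproj P - {p}"
    "yproj (P - {?o}) = yproj P" "zproj (P - {?o}) = zproj P"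
    unfolding AP[symmetric] by (simp_all add: im p)
qed

text \<open>The inverse of stripping is adding a corner in front: a set starting at level
  \<open>p + 1\<close> has no cell at level \<open>p\<close>, so the new corner acquires only the
  x-neighbour.\<close>

lemma branch_sets_single:
  assumes "p < u"
  shows "branch_sets p q r u v w True False False = insert (p, q, r) ` tight_sets (p + 1) q r u v w" (is "?L = ?R")
proof
  show "?L \<subseteq> ?R"
  proof
    fix P assume "P \<in> ?L"
    then have P: "P \<in> tight_sets p q r u v w" and n: "(p + 1, q, r) \<in> P" "(p, q + 1, r) \<notin> P" "(p, q, r + 1) \<notin> P"
      by (auto simp: branch_sets_def)
    have t: "tight (p, q, r) P" using P by (simp add: tight_sets_def)
    have "{p..u} - {p} = {p + 1..u}" by auto
    then have "P - {(p, q, r)} \<in> tight_sets (p + 1) q r u v w"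
      using tight_strip[OF t tight_sets_octant[OF P] n] P by (simp add: tight_sets_def)
    moreover have "P = insert (p, q, r) (P - {(p, q, r)})" using tight_sets_root[OF P] by auto
    ultimately show "P \<in> ?R" by blast
  qed
  show "?R \<subseteq> ?L"
  proof
    fix P assume "P \<in> ?R"
    then obtain K where P: "P = insert (p, q, r) K" and K: "K \<in> tight_sets (p + 1) q r u v w" by blast
    have t: "tight (p + 1, q, r) K" and im: "xproj K = {p + 1..u}" "yproj K = {q..v}" "zproj K = {r..w}"
      using K by (auto simp: tight_sets_def)
    have r: "(p + 1, q, r) \<in> K" using K by (rule tight_sets_root)
    have no: "(p, y, z) \<notin> K" for y z using tight_sets_box(1)[OF K] by fastforce
    have "q \<in> yproj K" "r \<in> zproj K" using r by force+
    then have im': "xproj P = {p..u}" "yproj P = {q..v}" "zproj P = {r..w}"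
      unfolding P using im assms by auto
    have "card P = card K + 1" unfolding P using no t by (simp add: tight_def)
    moreover have "card {p..u} = card {p + 1..u} + 1" using assms by simp
    moreover have "conn_from (p, q, r) P"
      unfolding P using t by (intro conn_from_insert) (auto simp: tight_def)
    ultimately have "tight (p, q, r) P"
      using t im im' unfolding tight_def P by simp
    then have "P \<in> tight_sets p q r u v w" using im' by (simp add: tight_sets_def)
    then show "P \<in> ?L" using r no by (auto simp: branch_sets_def P)
  qed
qed

lemma card_branch_sets_single:
  assumes "p < u"
  shows "card (branch_sets p q r u v w True False False) = card (tight_sets (p + 1) q r u v w)"
proof -
  have "inj_on (insert (p, q, r)) (tight_sets (p + 1) q r u v w)"
  proof (rule inj_on_inverseI)
    fix K assume K: "K \<in> tight_sets (p + 1) q r u v w"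
    then have "(p, q, r) \<notin> K" using tight_sets_box(1)[OF K] by fastforce
    then show "insert (p, q, r) K - {(p, q, r)} = K" by auto
  qed
  then show ?thesis using assms by (simp add: branch_sets_single card_image)
qed

text \<open>Converse of the cut. All four intersections have one element, so inclusion-exclusion
  subtracts 1 from the cardinalities and 3 from the projections, which turns the two equations into
  one.\<close>

lemma tight_wedge:
  assumes Q: "tight (p, q, r) Q" and R: "tight (p, q, r) R" and i: "Q \<inter> R = {(p, q, r)}"
    "xproj Q \<inter> xproj R = {p}" "yproj Q \<inter> yproj R = {q}" "zproj Q \<inter> zproj R = {r}"
  shows "tight (p, q, r) (Q \<union> R)"
proof -
  have fin: "finite Q" "finite R" using Q R by (auto simp: tight_def)
  have "conn_from (p, q, r) (Q \<union> R)"
    using Q R links_mono[of Q "Q \<union> R"] links_mono[of R "Q \<union> R"]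
    unfolding conn_from_def tight_def by blast
  moreover have "card (Q \<union> R) + 2 = card (xproj Q \<union> xproj R) + card (yproj Q \<union> yproj R) + card (zproj Q \<union> zproj R)"
    using card_Un_Int[of Q R] card_Un_Int[of "xproj Q" "xproj R"] card_Un_Int[of "yproj Q" "yproj R"]
      card_Un_Int[of "zproj Q" "zproj R"] fin Q R by (simp add: i tight_def)
  ultimately show ?thesis using fin by (simp add: tight_def image_Un)
qed

section \<open>Symmetries\<close>

text \<open>A transposition and a 3-cycle generate all coordinate permutations, so it suffices to
  treat the x-direction, or the pair x and y, directly.\<close>

definition swap_xy :: "cell \<Rightarrow> cell" where "swap_xy c = (fst (snd c), fst c, snd (snd c))"
definition cycle_xyz :: "cell \<Rightarrow> cell" where "cycle_xyz c = (fst (snd c), snd (snd c), fst c)"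
definition translate :: "cell \<Rightarrow> cell \<Rightarrow> cell" where
  "translate d c = (fst d + fst c, fst (snd d) + fst (snd c), snd (snd d) + snd (snd c))"

lemma conn_from_image:
  assumes "\<And>x y. adjacent x y \<Longrightarrow> adjacent (f x) (f y)" "conn_from a P"
  shows "conn_from (f a) (f ` P)"
proof (rule conn_fromI)
  have *: "(f a, f x) \<in> (links (f ` P))\<^sup>*" if "(a, x) \<in> (links P)\<^sup>*" for x
    using that
  proof induction
    case (step y z)
    then have "(f y, f z) \<in> links (f ` P)" using assms(1) by (auto simp: links_def)
    then show ?case using step.IH by (rule rtrancl_into_rtrancl[rotated])
  qed simp
  show "(f a, x) \<in> (links (f ` P))\<^sup>*" if "x \<in> f ` P" for x
    using that * assms(2) by (auto simp: conn_from_def)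
  show "f a \<in> f ` P" using assms(2) by (auto simp: conn_from_def)
qed

lemma adjacent_maps:
  "adjacent x y \<Longrightarrow> adjacent (swap_xy x) (swap_xy y)" "adjacent x y \<Longrightarrow> adjacent (cycle_xyz x) (cycle_xyz y)"
  "adjacent x y \<Longrightarrow> adjacent (translate d x) (translate d y)"
  by (cases x; cases y; auto simp: swap_xy_def cycle_xyz_def translate_def)+

lemma inj_maps: "inj swap_xy" "inj cycle_xyz" "inj (translate d)"
  by (auto simp: inj_def swap_xy_def cycle_xyz_def translate_def prod_eq_iff)

lemma swap_xy_swap_xy [simp]: "swap_xy (swap_xy c) = c" and cycle_xyz_cycle_xyz [simp]: "cycle_xyz (cycle_xyz (cycle_xyz c)) = c"
  by (simp_all add: swap_xy_def cycle_xyz_def)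

lemma tight_sets_swap_xy: "P \<in> tight_sets p q r u v w \<Longrightarrow> swap_xy ` P \<in> tight_sets q p r v u w"
  using conn_from_image[of swap_xy "(p, q, r)" P, OF adjacent_maps(1)] card_image[of swap_xy P] inj_maps(1)
  by (auto simp: tight_sets_def tight_def image_image swap_xy_def inj_on_subset)

lemma tight_sets_cycle_xyz: "P \<in> tight_sets p q r u v w \<Longrightarrow> cycle_xyz ` P \<in> tight_sets q r p v w u"
  using conn_from_image[of cycle_xyz "(p, q, r)" P, OF adjacent_maps(2)] card_image[of cycle_xyz P] inj_maps(2)
  by (auto simp: tight_sets_def tight_def image_image cycle_xyz_def inj_on_subset)

lemma tight_sets_translate:
  assumes "P \<in> tight_sets p q r u v w"
  shows "translate (a, b, c) ` P \<in> tight_sets (a + p) (b + q) (c + r) (a + u) (b + v) (c + w)"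
proof -
  let ?T = "translate (a, b, c) ` P"
  have im: "xproj ?T = (+) a ` xproj P" "yproj ?T = (+) b ` yproj P" "zproj ?T = (+) c ` zproj P"
    by (simp_all add: image_image translate_def)
  then have "card (xproj ?T) = card (xproj P)" "card (yproj ?T) = card (yproj P)" "card (zproj ?T) = card (zproj P)"
    by (simp_all only: card_image[OF inj_on_add])
  moreover have "card ?T = card P"
    by (rule card_image, rule inj_on_subset[OF inj_maps(3)]) simp
  moreover have "conn_from (translate (a, b, c) (p, q, r)) ?T"
    using assms by (intro conn_from_image adjacent_maps) (simp_all add: tight_sets_def tight_def)
  ultimately have "tight (a + p, b + q, c + r) ?T"
    using assms by (simp add: tight_sets_def tight_def translate_def)
  then show ?thesis using assms by (simp add: tight_sets_def im)
qed

lemma mem_swap_xy: "(i, j, l) \<in> swap_xy ` P \<longleftrightarrow> (j, i, l) \<in> P"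
  by (force simp: swap_xy_def image_iff)

lemma mem_cycle_xyz: "(i, j, l) \<in> cycle_xyz ` P \<longleftrightarrow> (l, i, j) \<in> P"
  by (force simp: cycle_xyz_def image_iff)

lemma branch_sets_swap_xy: "P \<in> branch_sets p q r u v w a b c \<Longrightarrow> swap_xy ` P \<in> branch_sets q p r v u w b a c"
  using tight_sets_swap_xy by (simp add: branch_sets_def mem_swap_xy)

lemma branch_sets_cycle_xyz: "P \<in> branch_sets p q r u v w a b c \<Longrightarrow> cycle_xyz ` P \<in> branch_sets q r p v w u b c a"
  using tight_sets_cycle_xyz by (simp add: branch_sets_def mem_cycle_xyz)

lemma swap_xy_image [simp]: "swap_xy ` swap_xy ` P = P" and cycle_xyz_image [simp]: "cycle_xyz ` cycle_xyz ` cycle_xyz ` P = P"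
  by (simp_all add: image_image)

lemma card_branch_sets_swap_xy: "card (branch_sets p q r u v w a b c) = card (branch_sets q p r v u w b a c)"
proof (rule bij_betw_same_card)
  show "bij_betw ((`) swap_xy) (branch_sets p q r u v w a b c) (branch_sets q p r v u w b a c)"
    by (rule bij_betw_byWitness[where f' = "(`) swap_xy"]) (use branch_sets_swap_xy in \<open>simp_all add: image_subset_iff\<close>)
qed

text \<open>\<open>cycle_xyz\<close> has order three, so applying it twice gives its
  inverse.\<close>

lemma card_branch_sets_cycle_xyz: "card (branch_sets p q r u v w a b c) = card (branch_sets q r p v w u b c a)"
proof (rule bij_betw_same_card)
  show "bij_betw ((`) cycle_xyz) (branch_sets p q r u v w a b c) (branch_sets q r p v w u b c a)"
    by (rule bij_betw_byWitness[where f' = "\<lambda>P. cycle_xyz ` cycle_xyz ` P"])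
      (use branch_sets_cycle_xyz in \<open>simp_all add: image_subset_iff\<close>)
qed

lemma card_tight_sets_swap_xy: "card (tight_sets p q r u v w) = card (tight_sets q p r v u w)"
proof (rule bij_betw_same_card)
  show "bij_betw ((`) swap_xy) (tight_sets p q r u v w) (tight_sets q p r v u w)"
    by (rule bij_betw_byWitness[where f' = "(`) swap_xy"]) (use tight_sets_swap_xy in \<open>simp_all add: image_subset_iff\<close>)
qed

lemma card_tight_sets_cycle_xyz: "card (tight_sets p q r u v w) = card (tight_sets q r p v w u)"
proof (rule bij_betw_same_card)
  show "bij_betw ((`) cycle_xyz) (tight_sets p q r u v w) (tight_sets q r p v w u)"
    by (rule bij_betw_byWitness[where f' = "\<lambda>P. cycle_xyz ` cycle_xyz ` P"])
      (use tight_sets_cycle_xyz in \<open>simp_all add: image_subset_iff\<close>)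
qed

lemma card_tight_sets_translate: "card (tight_sets (a + p) (b + q) (c + r) (a + u) (b + v) (c + w)) = card (tight_sets p q r u v w)"
proof (rule bij_betw_same_card[symmetric])
  have inv: "translate (-a, -b, -c) ` translate (a, b, c) ` P = P" "translate (a, b, c) ` translate (-a, -b, -c) ` P = P" for P
    by (simp_all add: image_image translate_def)
  show "bij_betw ((`) (translate (a, b, c))) (tight_sets p q r u v w) (tight_sets (a + p) (b + q) (c + r) (a + u) (b + v) (c + w))"
    by (rule bij_betw_byWitness[where f' = "(`) (translate (-a, -b, -c))"])
      (use tight_sets_translate[of _ p q r u v w a b c] tight_sets_translate[of _ "a+p" "b+q" "c+r" "a+u" "b+v" "c+w" "-a" "-b" "-c"] inv in auto)
qed

section \<open>Straight arms and the gluing of branches at the corner\<close>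

lemma tight_sets_line:
  assumes "p \<le> u"
  shows "tight_sets p q r u q r = {{p..u} \<times> {q} \<times> {r}}"
proof -
  let ?L = "{p..u} \<times> {q} \<times> {r}"
  have im: "xproj ?L = {p..u}" "yproj ?L = {q}" "zproj ?L = {r}"
    using assms by force+
  have "x \<le> u \<longrightarrow> ((p, q, r), (x, q, r)) \<in> (links ?L)\<^sup>*" if "p \<le> x" for x
    using that
  proof (induction x rule: int_ge_induct)
    case (step x)
    show ?case
    proof
      assume "x + 1 \<le> u"
      then have "((p, q, r), (x, q, r)) \<in> (links ?L)\<^sup>*" using step by simp
      then show "((p, q, r), (x + 1, q, r)) \<in> (links ?L)\<^sup>*"
        by (rule links_step) (use step \<open>x + 1 \<le> u\<close> in auto)
    qed
  qed simp
  then have "conn_from (p, q, r) ?L"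
    using assms by (auto intro!: conn_fromI)
  then have "tight (p, q, r) ?L"
    unfolding tight_def im by simp
  then have "?L \<in> tight_sets p q r u q r" using im by (simp add: tight_sets_def)
  \<comment> \<open>With y and z constant, a cell is determined by its x-coordinate, so the full
    x-projection forces the whole line.\<close>
  moreover have "P = ?L" if P: "P \<in> tight_sets p q r u q r" for P
  proof
    show "P \<subseteq> ?L" using tight_sets_box[OF P] by fastforce
    show "?L \<subseteq> P"
    proof
      fix c assume c: "c \<in> ?L"
      then have "fst c \<in> xproj P" using P by (auto simp: tight_sets_def)
      then obtain d where "d \<in> P" "fst d = fst c" by force
      moreover have "d = c" using tight_sets_box[OF P \<open>d \<in> P\<close>] c calculation by (auto simp: prod_eq_iff)
      ultimately show "c \<in> P" by simp
    qed
  qed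
  ultimately show ?thesis by blast
qed

lemma tight_sets_line_y:
  assumes "q \<le> v"
  shows "tight_sets p q r p v r = {{p} \<times> {q..v} \<times> {r}}"
proof -
  have e: "swap_xy ` ({q..v} \<times> {p} \<times> {r}) = {p} \<times> {q..v} \<times> {r}"
    by (force simp: swap_xy_def image_iff)
  have "P \<in> tight_sets p q r p v r \<longleftrightarrow> swap_xy ` P \<in> tight_sets q p r v p r" for P
    using tight_sets_swap_xy[of P p q r p v r] tight_sets_swap_xy[of "swap_xy ` P" q p r v p r] by (auto simp: image_image)
  then have "P \<in> tight_sets p q r p v r \<longleftrightarrow> swap_xy ` P = {q..v} \<times> {p} \<times> {r}" for P
    using tight_sets_line[OF assms] by simp
  moreover have "swap_xy ` P = X \<longleftrightarrow> P = swap_xy ` X" for P X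
    by (auto simp: image_image)
  ultimately show ?thesis using e by auto
qed

lemma tight_sets_nonempty_le:
  assumes "Q \<in> tight_sets p q r u v w"
  shows "p \<le> u" "q \<le> v" "r \<le> w"
  using tight_sets_box[OF assms tight_sets_root[OF assms]] by auto

text \<open>Since each coordinate varies in at most one piece, the pieces meet only in the corner,
  and each \<open>max\<close> is the end of the piece in which that coordinate varies.\<close>

lemma tight_sets_wedge:
  assumes Q: "Q \<in> tight_sets p q r u v w" and R: "R \<in> tight_sets p q r u' v' w'"
    and e: "u = p \<or> u' = p" "v = q \<or> v' = q" "w = r \<or> w' = r"
  shows "Q \<union> R \<in> tight_sets p q r (max u u') (max v v') (max w w')"
proof -
  note le = tight_sets_nonempty_le[OF Q] tight_sets_nonempty_le[OF R]
  have im: "xproj Q = {p..u}" "yproj Q = {q..v}" "zproj Q = {r..w}"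
    "xproj R = {p..u'}" "yproj R = {q..v'}" "zproj R = {r..w'}"
    using Q R by (simp_all add: tight_sets_def)
  have i: "xproj Q \<inter> xproj R = {p}" "yproj Q \<inter> yproj R = {q}" "zproj Q \<inter> zproj R = {r}"
    unfolding im using e le by auto
  have "c = (p, q, r)" if c: "c \<in> Q" "c \<in> R" for c
  proof -
    have "fst c = p" using tight_sets_box(1,2)[OF Q c(1)] tight_sets_box(1,2)[OF R c(2)] e(1) by linarith
    moreover have "fst (snd c) = q" using tight_sets_box(3,4)[OF Q c(1)] tight_sets_box(3,4)[OF R c(2)] e(2) by linarith
    moreover have "snd (snd c) = r" using tight_sets_box(5,6)[OF Q c(1)] tight_sets_box(5,6)[OF R c(2)] e(3) by linarith
    ultimately show ?thesis by (simp add: prod_eq_iff)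
  qed
  then have "Q \<inter> R = {(p, q, r)}"
    using tight_sets_root[OF Q] tight_sets_root[OF R] by blast
  moreover have "tight (p, q, r) Q" "tight (p, q, r) R" using Q R by (simp_all add: tight_sets_def)
  ultimately have t: "tight (p, q, r) (Q \<union> R)"
    using i by (intro tight_wedge)
  have "xproj (Q \<union> R) = {p..max u u'}" "yproj (Q \<union> R) = {q..max v v'}" "zproj (Q \<union> R) = {r..max w w'}"
    unfolding image_Un im using le by auto
  then show ?thesis using t by (simp add: tight_sets_def)
qed

text \<open>
  When the corner has neighbours in the x- and the y-direction, the z-coordinate varies in at most one
  of the two branches; the first image collects the sets whose x-branch is a straight arm, the
  second those whose y-branch is one.
\<close>

lemma branch_sets_pair:
  assumes pq: "p < u" "q < v" and rw: "r \<le> w"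
  shows "branch_sets p q r u v w True True c =
    (\<lambda>Q. Q \<union> {p..u} \<times> {q} \<times> {r}) ` branch_sets p q r p v w False True c \<union>
    (if c then {} else (\<lambda>Q. Q \<union> {p} \<times> {q..v} \<times> {r}) ` branch_sets p q r u q w True False False)"
    (is "?L = ?f ` ?A \<union> ?B")
proof
  let ?o = "(p, q, r)"
  let ?X = "{p..u} \<times> {q} \<times> {r}" and ?Y = "{p} \<times> {q..v} \<times> {r}"
  have X: "tight_sets p q r u q r = {?X}" and Y: "tight_sets p q r p v r = {?Y}"
    using tight_sets_line tight_sets_line_y pq by auto
  show "?L \<subseteq> ?f ` ?A \<union> ?B"
  proof
    fix P assume "P \<in> ?L"
    then have P: "P \<in> tight_sets p q r u v w" and n: "(p + 1, q, r) \<in> P" "(p, q + 1, r) \<in> P"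
      "(p, q, r + 1) \<in> P \<longleftrightarrow> c"
      by (auto simp: branch_sets_def)
    have t: "tight ?o P" and im: "xproj P = {p..u}" "yproj P = {q..v}" "zproj P = {r..w}"
      using P by (auto simp: tight_sets_def)
    obtain A where A: "(p + 1, q, r) \<in> A" "A \<subseteq> P - {?o}" "conn_from (p + 1, q, r) A"
      "tight ?o (insert ?o A)" "tight ?o (P - A)"
      "\<forall>m\<in>A. adjacent ?o m \<longrightarrow> m = (p + 1, q, r)"
      "xproj (insert ?o A) = {p} \<or> xproj (P - A) = {p}"
      "yproj (insert ?o A) = {q} \<or> yproj (P - A) = {q}"
      "zproj (insert ?o A) = {r} \<or> zproj (P - A) = {r}"
    proof (rule tight_split[OF t tight_sets_octant[OF P] n(1)])
      show "adjacent ?o (p + 1, q, r)" by simp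
    qed
    define B where "B = insert ?o A"
    define C where "C = P - A"
    have PBC: "P = B \<union> C" unfolding B_def C_def using A(2) tight_sets_root[OF P] by blast
    have oC: "?o \<in> C" and oB: "?o \<in> B" unfolding B_def C_def using A(2) tight_sets_root[OF P] by blast+
    have nA: "(p, q + 1, r) \<notin> A" "(p, q, r + 1) \<notin> A"
      using bspec[OF A(6), of "(p, q + 1, r)"] bspec[OF A(6), of "(p, q, r + 1)"] by auto
    have un: "xproj B \<union> xproj C = {p..u}" "yproj B \<union> yproj C = {q..v}" "zproj B \<union> zproj C = {r..w}"
      using im unfolding PBC image_Un by blast+
    have root: "p \<in> xproj B" "q \<in> yproj B" "r \<in> zproj B" "p \<in> xproj C" "q \<in> yproj C" "r \<in> zproj C"
      using imageI[OF oB, of fst] imageI[OF oB, of "\<lambda>c. fst (snd c)"] imageI[OF oB, of "\<lambda>c. snd (snd c)"]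
        imageI[OF oC, of fst] imageI[OF oC, of "\<lambda>c. fst (snd c)"] imageI[OF oC, of "\<lambda>c. snd (snd c)"]
      by simp_all
    have nB: "(p + 1, q, r) \<in> B" using A(1) by (simp add: B_def)
    have nC: "(p, q + 1, r) \<in> C" using n(2) nA by (simp add: C_def)
    have dis: "xproj B = {p} \<or> xproj C = {p}" "yproj B = {q} \<or> yproj C = {q}"
      "zproj B = {r} \<or> zproj C = {r}"
      unfolding B_def C_def by (fact A)+
    \<comment> \<open>The x-neighbour lies in \<open>B\<close> and the y-neighbour in
      \<open>C\<close>, so x is constant on \<open>C\<close> and y is constant on
      \<open>B\<close>.\<close>
    have "p + 1 \<in> xproj B" using imageI[OF nB, of fst] by simp
    then have xC: "xproj C = {p}" using dis(1) by (metis singletonD less_add_one less_irrefl)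
    have "q + 1 \<in> yproj C" using imageI[OF nC, of "\<lambda>c. fst (snd c)"] by simp
    then have yB: "yproj B = {q}" using dis(2) by (metis singletonD less_add_one less_irrefl)
    have xB: "xproj B = {p..u}" using un(1) root(1) unfolding xC by blast
    have yC: "yproj C = {q..v}" using un(2) root(5) unfolding yB by blast
    have tB: "tight ?o B" "tight ?o C" unfolding B_def C_def by (fact A)+
    show "P \<in> ?f ` ?A \<union> ?B"
    \<comment> \<open>Only z is still unassigned; the piece on which it is constant is a straight
      arm.\<close>
    proof (cases "zproj B = {r}")
      case True
      then have zC: "zproj C = {r..w}" using un(3) root(6) by blast
      have "B \<in> tight_sets p q r u q r" using tB xB yB True by (simp add: tight_sets_def)
      then have BX: "B = ?X" using X by simp
      have C: "C \<in> tight_sets p q r p v w" using tB xC yC zC by (simp add: tight_sets_def)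
      have "(p + 1, q, r) \<notin> C" using A(1) by (simp add: C_def)
      moreover have "(p, q, r + 1) \<in> C \<longleftrightarrow> c" using n nA by (simp add: C_def)
      ultimately have "C \<in> ?A" using C nC by (simp add: branch_sets_def)
      moreover have "P = ?f C" using PBC BX by auto
      ultimately show ?thesis by blast
    next
      case False
      then have zC: "zproj C = {r}" using dis(3) by blast
      then have zB: "zproj B = {r..w}" using un(3) root(3) by blast
      have "C \<in> tight_sets p q r p v r" using tB xC yC zC by (simp add: tight_sets_def)
      then have CY: "C = ?Y" using Y by simp
      have B: "B \<in> tight_sets p q r u q w" using tB xB yB zB by (simp add: tight_sets_def)
      have nB': "(p, q + 1, r) \<notin> B" "(p, q, r + 1) \<notin> B" using nA by (simp_all add: B_def)
      then have "B \<in> branch_sets p q r u q w True False False" using B nB by (simp add: branch_sets_def)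
      \<comment> \<open>Neither the x-branch nor the y-arm contains the z-neighbour, hence the empty
        second family when \<open>c\<close> holds.\<close>
      moreover have "\<not> c" using n(3) nB' PBC CY by auto
      ultimately show ?thesis using PBC CY by auto
    qed
  qed
  show "?f ` ?A \<union> ?B \<subseteq> ?L"
  proof
    fix P assume "P \<in> ?f ` ?A \<union> ?B"
    then consider Q where "Q \<in> ?A" "P = Q \<union> ?X"
      | Q where "\<not> c" "Q \<in> branch_sets p q r u q w True False False" "P = Q \<union> ?Y"
      by (auto split: if_splits)
    then show "P \<in> ?L"
    proof cases
      case 1
      have "Q \<union> ?X \<in> tight_sets p q r (max p u) (max v q) (max w r)"
        by (rule tight_sets_wedge) (use 1 X in \<open>auto simp: branch_sets_def\<close>)
      then show ?thesis using 1 pq rw by (simp add: branch_sets_def max_def)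
    next
      case 2
      have "Q \<union> ?Y \<in> tight_sets p q r (max u p) (max q v) (max w r)"
        by (rule tight_sets_wedge) (use 2 Y in \<open>auto simp: branch_sets_def\<close>)
      then show ?thesis using 2 pq rw by (simp add: branch_sets_def max_def)
    qed
  qed
qed

section \<open>Counting the classes of tight sets\<close>

lemma inj_on_union_line:
  "inj_on (\<lambda>Q. Q \<union> {p..u} \<times> {q} \<times> {r}) (tight_sets p q r p v w)"
proof (rule inj_on_inverseI)
  fix Q assume Q: "Q \<in> tight_sets p q r p v w"
  \<comment> \<open>\<open>Q\<close> is recovered as the slice at level \<open>p\<close>: the arm
    meets this slice at most in the corner, which belongs to \<open>Q\<close>.\<close>
  show "(Q \<union> {p..u} \<times> {q} \<times> {r}) \<inter> {p} \<times> UNIV = Q"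
    using tight_sets_box[OF Q] tight_sets_root[OF Q] by (auto simp: mem_Times_iff order_antisym)
qed

lemma inj_on_union_line_y:
  "inj_on (\<lambda>Q. Q \<union> {p} \<times> {q..v} \<times> {r}) (tight_sets p q r u q w)"
proof (rule inj_on_inverseI)
  fix Q assume Q: "Q \<in> tight_sets p q r u q w"
  show "(Q \<union> {p} \<times> {q..v} \<times> {r}) \<inter> UNIV \<times> {q} \<times> UNIV = Q"
    using tight_sets_box[OF Q] tight_sets_root[OF Q] by (auto simp: mem_Times_iff order_antisym)
qed

lemma branch_sets_empty: "u = p \<Longrightarrow> branch_sets p q r u v w True b c = {}"
  "v = q \<Longrightarrow> branch_sets p q r u v w a True c = {}"
  "w = r \<Longrightarrow> branch_sets p q r u v w a b True = {}"
  using tight_sets_box(2)[of _ p q r u v w "(p + 1, q, r)"] tight_sets_box(4)[of _ p q r u v w "(p, q + 1, r)"]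
    tight_sets_box(6)[of _ p q r u v w "(p, q, r + 1)"]
  by (auto simp: branch_sets_def)

text \<open>A connected set whose corner has no neighbour is the corner alone, so all its
  projections are singletons.\<close>

lemma branch_sets_none:
  assumes "p < u \<or> q < v \<or> r < w"
  shows "branch_sets p q r u v w False False False = {}"
proof (rule ccontr)
  assume "\<not> ?thesis"
  then obtain P where P: "P \<in> tight_sets p q r u v w" "(p + 1, q, r) \<notin> P" "(p, q + 1, r) \<notin> P" "(p, q, r + 1) \<notin> P"
    by (auto simp: branch_sets_def)
  have "P = {(p, q, r)}"
  proof (rule conn_from_no_neighbour)
    show "conn_from (p, q, r) P" using P by (simp add: tight_sets_def tight_def)
    show "\<not> adjacent (p, q, r) x" if "x \<in> P" for x
      using octant_neighbour[of x p q r] tight_sets_octant[OF P(1)] that P by blast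
  qed
  moreover have "u \<in> xproj P" "v \<in> yproj P" "w \<in> zproj P"
    using P(1) tight_sets_nonempty_le[OF P(1)] by (simp_all add: tight_sets_def)
  ultimately show False using assms by simp
qed

lemma card_split: "finite X \<Longrightarrow> card X = card {x \<in> X. Q x} + card {x \<in> X. \<not> Q x}"
  by (subst card_Un_disjoint[symmetric]) (auto intro: arg_cong[where f = card])

lemma card_tight_sets_by_branches:
  "card (tight_sets p q r u v w) =
     card (branch_sets p q r u v w True True True) + card (branch_sets p q r u v w True True False) +
     card (branch_sets p q r u v w True False True) + card (branch_sets p q r u v w True False False) +
     card (branch_sets p q r u v w False True True) + card (branch_sets p q r u v w False True False) +
     card (branch_sets p q r u v w False False True) + card (branch_sets p q r u v w False False False)"
proof -
  let ?a = "\<lambda>P. (p + 1, q, r) \<in> P" and ?b = "\<lambda>P. (p, q + 1, r) \<in> P" and ?c = "\<lambda>P. (p, q, r + 1) \<in> P"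
  let ?branch_sets = "branch_sets p q r u v w"
  have e1: "card {P \<in> tight_sets p q r u v w. ?a P = a \<and> ?b P = b} = card (?branch_sets a b True) + card (?branch_sets a b False)" for a b
    using card_split[of "{P \<in> tight_sets p q r u v w. ?a P = a \<and> ?b P = b}" ?c] finite_tight_sets
    by (simp add: branch_sets_def conj_assoc)
  have e2: "card {P \<in> tight_sets p q r u v w. ?a P = a} =
    card {P \<in> tight_sets p q r u v w. ?a P = a \<and> ?b P = True} + card {P \<in> tight_sets p q r u v w. ?a P = a \<and> ?b P = False}" for a
    using card_split[of "{P \<in> tight_sets p q r u v w. ?a P = a}" ?b] finite_tight_sets
    by (simp add: conj_assoc)
  have e3: "card (tight_sets p q r u v w) = card {P \<in> tight_sets p q r u v w. ?a P = True} + card {P \<in> tight_sets p q r u v w. ?a P = False}"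
    using card_split[of "tight_sets p q r u v w" ?a] finite_tight_sets by simp
  show ?thesis by (simp only: e3 e2 e1 add.assoc)
qed

lemma card_branch_sets_y:
  assumes "q < v"
  shows "card (branch_sets p q r u v w False True False) = card (tight_sets p (q + 1) r u v w)"
  using card_branch_sets_swap_xy[of p q r u v w False True False] card_branch_sets_single[OF assms, of p r u w]
    card_tight_sets_swap_xy[of p "q + 1" r u v w] by simp

lemma card_branch_sets_z:
  assumes "r < w"
  shows "card (branch_sets p q r u v w False False True) = card (tight_sets p q (r + 1) u v w)"
  using card_branch_sets_cycle_xyz[of r p q w u v True False False] card_branch_sets_single[OF assms, of p q u v]
    card_tight_sets_cycle_xyz[of "r + 1" p q w u v] by simp

text \<open>Once the corner is stripped, the set starts at level \<open>q + 1\<close>. This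
  separates the two families in \<open>card_branch_sets_pair\<close>.\<close>

lemma branch_sets_y_above:
  assumes "q < v" and P: "P \<in> branch_sets p q r u v w False True False" "c \<in> P" "c \<noteq> (p, q, r)"
  shows "q < fst (snd c)"
proof -
  have "swap_xy ` P \<in> insert (q, p, r) ` tight_sets (q + 1) p r v u w"
    using branch_sets_swap_xy[OF P(1)] branch_sets_single[OF assms(1)] by simp
  then obtain K where K: "K \<in> tight_sets (q + 1) p r v u w" "swap_xy ` P = insert (q, p, r) K" by blast
  have "swap_xy c \<noteq> (q, p, r)" using P(3) by (auto simp: swap_xy_def prod_eq_iff)
  then have "swap_xy c \<in> K" using K(2) P(2) by blast
  then show ?thesis using tight_sets_box(1)[OF K(1)] by (fastforce simp: swap_xy_def)
qed

text \<open>Without extent in z, both families of \<open>branch_sets_pair\<close> consist of the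
  same L-shaped union of two arms.\<close>

lemma card_branch_sets_pair_flat:
  assumes "p < u" "q < v"
  shows "card (branch_sets p q r u v r True True False) = 1"
proof -
  let ?X = "{p..u} \<times> {q} \<times> {r}" and ?Y = "{p} \<times> {q..v} \<times> {r}"
  have Y: "tight_sets p q r p v r = {?Y}" and X: "tight_sets p q r u q r = {?X}"
    using tight_sets_line_y tight_sets_line assms by simp_all
  have "(p + 1, q, r) \<in> ?X" "(p, q + 1, r) \<notin> ?X" "(p, q, r + 1) \<notin> ?X"
    "(p + 1, q, r) \<notin> ?Y" "(p, q + 1, r) \<in> ?Y" "(p, q, r + 1) \<notin> ?Y"
    using assms by simp_all
  then have "branch_sets p q r p v r False True False = {?Y}" "branch_sets p q r u q r True False False = {?X}"
    unfolding branch_sets_def X Y by blast+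
  then have "branch_sets p q r u v r True True False = {?Y \<union> ?X} \<union> {?X \<union> ?Y}"
    using branch_sets_pair[OF assms, of r r False] by simp
  then have "branch_sets p q r u v r True True False = {?X \<union> ?Y}" by (simp only: Un_commute[of ?Y] Un_absorb)
  then show ?thesis by simp
qed

text \<open>In contrast to the flat case, a positive extent in z makes the two families disjoint.
  Stripping the corner from the planar branch yields the two summands.\<close>

lemma card_branch_sets_pair:
  assumes "p < u" "q < v" "r < w"
  shows "card (branch_sets p q r u v w True True False) = card (tight_sets p (q + 1) r p v w) + card (tight_sets (p + 1) q r u q w)"
proof -
  let ?A = "branch_sets p q r p v w False True False" and ?B = "branch_sets p q r u q w True False False"
  let ?f = "\<lambda>Q. Q \<union> {p..u} \<times> {q} \<times> {r}" and ?g = "\<lambda>Q. Q \<union> {p} \<times> {q..v} \<times> {r}"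
  \<comment> \<open>A cell at height \<open>w\<close> lies in the planar branch; it has \<open>y > q\<close> in the first family, \<open>y = q\<close> in the second.\<close>
  have "?f ` ?A \<inter> ?g ` ?B = {}"
  proof (rule ccontr)
    assume "\<not> ?thesis"
    then obtain Q R where Q: "Q \<in> ?A" and R: "R \<in> ?B" and e: "?f Q = ?g R" by blast
    have QF: "Q \<in> tight_sets p q r p v w" and RF: "R \<in> tight_sets p q r u q w" using Q R by (auto simp: branch_sets_def)
    have "w \<in> zproj Q" using QF assms by (auto simp: tight_sets_def)
    then obtain c where c: "c \<in> Q" "snd (snd c) = w" by force
    have ne: "c \<noteq> (p, q, r)" using c assms by auto
    have "c \<in> ?g R" using e c by blast
    then have "c \<in> R" using c assms by auto
    then have "fst (snd c) \<le> q" using tight_sets_box(4)[OF RF] by blast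
    moreover have "q < fst (snd c)" using branch_sets_y_above[OF assms(2) Q c(1) ne] .
    ultimately show False by simp
  qed
  moreover have "card (?f ` ?A) = card ?A"
    by (rule card_image, rule inj_on_subset[OF inj_on_union_line]) (auto simp: branch_sets_def)
  moreover have "card (?g ` ?B) = card ?B"
    by (rule card_image, rule inj_on_subset[OF inj_on_union_line_y]) (auto simp: branch_sets_def)
  ultimately show ?thesis
    using branch_sets_pair[OF assms(1,2), of r w False] assms
    by (simp add: card_Un_disjoint finite_branch_sets card_branch_sets_y card_branch_sets_single)
qed

text \<open>Splitting off the x-arm leaves a flat set in the yz-plane whose corner has both
  neighbours, so only the tripod of three arms remains.\<close>

lemma card_branch_sets_triple:
  assumes "p < u" "q < v" "r < w"
  shows "card (branch_sets p q r u v w True True True) = 1"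
proof -
  have "card (branch_sets p q r u v w True True True) = card (branch_sets p q r p v w False True True)"
  proof -
    have e: "branch_sets p q r u v w True True True
        = (\<lambda>Q. Q \<union> {p..u} \<times> {q} \<times> {r}) ` branch_sets p q r p v w False True True"
      using branch_sets_pair[OF assms(1,2), of r w True] assms(3) by simp
    show ?thesis
      unfolding e by (rule card_image, rule inj_on_subset[OF inj_on_union_line]) (auto simp: branch_sets_def)
  qed
  also have "\<dots> = 1"
    using card_branch_sets_cycle_xyz[of p q r p v w False True True] card_branch_sets_pair_flat[OF assms(2,3)] by simp
  finally show ?thesis .
qed

section \<open>Counting\<close>

text \<open>The arguments are side lengths minus one, matching the lower entries of the trinomial
  coefficient and making zero the degenerate case.\<close>

definition tight_count :: "nat \<Rightarrow> nat \<Rightarrow> nat \<Rightarrow> nat" where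
  "tight_count x y z = card (tight_sets 1 1 1 (1 + int x) (1 + int y) (1 + int z))"

lemma card_tight_sets_eq_count: "card (tight_sets p q r (p + int x) (q + int y) (r + int z)) = tight_count x y z"
  using card_tight_sets_translate[of "p - 1" 1 "q - 1" 1 "r - 1" 1 "1 + int x" "1 + int y" "1 + int z"]
  by (simp add: tight_count_def algebra_simps)

lemma tight_count_swap_xy: "tight_count x y z = tight_count y x z"
  unfolding tight_count_def by (rule card_tight_sets_swap_xy)

lemma tight_count_cycle_xyz: "tight_count x y z = tight_count y z x"
  unfolding tight_count_def by (rule card_tight_sets_cycle_xyz)

lemma tight_count_line: "tight_count x 0 0 = 1"
  using tight_sets_line[of 1 "1 + int x" 1 1] by (simp add: tight_count_def)

text \<open>The corner has only an x-neighbour, only a y-neighbour, or both; the last case is the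
  single L-shape.\<close>

lemma tight_count_flat: "tight_count (Suc x) (Suc y) 0 = tight_count x (Suc y) 0 + tight_count (Suc x) y 0 + 1"
proof -
  have 1: "card (tight_sets 2 1 1 (1 + int (Suc x)) (1 + int (Suc y)) 1) = tight_count x (Suc y) 0"
    using card_tight_sets_eq_count[of 2 1 1 x "Suc y" 0] by (simp add: algebra_simps)
  have 2: "card (tight_sets 1 2 1 (1 + int (Suc x)) (1 + int (Suc y)) 1) = tight_count (Suc x) y 0"
    using card_tight_sets_eq_count[of 1 2 1 "Suc x" y 0] by (simp add: algebra_simps)
  have 3: "card (branch_sets 1 1 1 (1 + int (Suc x)) (1 + int (Suc y)) 1 True True False) = 1"
    by (rule card_branch_sets_pair_flat) auto
  have 4: "card (branch_sets 1 1 1 (1 + int (Suc x)) (1 + int (Suc y)) 1 True False False)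
      = card (tight_sets 2 1 1 (1 + int (Suc x)) (1 + int (Suc y)) 1)"
    using card_branch_sets_single[of 1 "1 + int (Suc x)"] by simp
  have 5: "card (branch_sets 1 1 1 (1 + int (Suc x)) (1 + int (Suc y)) 1 False True False)
      = card (tight_sets 1 2 1 (1 + int (Suc x)) (1 + int (Suc y)) 1)"
    using card_branch_sets_y[of 1 "1 + int (Suc y)"] by simp
  show ?thesis
    using card_tight_sets_by_branches[of 1 1 1 "1 + int (Suc x)" "1 + int (Suc y)" 1]
    by (simp only: 1 2 3 4 5 branch_sets_empty(3) branch_sets_none tight_count_def) (simp add: branch_sets_none)
qed

text \<open>One neighbour gives a shortened box, two neighbours give two planar counts for each of
  the three pairs, and three neighbours give the tripod.\<close>

lemma tight_count_solid:
  "tight_count (Suc x) (Suc y) (Suc z) =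
     tight_count x (Suc y) (Suc z) + tight_count (Suc x) y (Suc z) + tight_count (Suc x) (Suc y) z
     + (tight_count x (Suc z) 0 + tight_count (Suc x) z 0) + (tight_count x (Suc y) 0 + tight_count (Suc x) y 0)
     + (tight_count y (Suc z) 0 + tight_count (Suc y) z 0) + 1"
proof -
  let ?u = "1 + int (Suc x)" and ?v = "1 + int (Suc y)" and ?w = "1 + int (Suc z)"
  have pos: "(1::int) < ?u" "(1::int) < ?v" "(1::int) < ?w" by auto
  have 1: "card (branch_sets 1 1 1 ?u ?v ?w True False False) = tight_count x (Suc y) (Suc z)"
    using card_branch_sets_single[OF pos(1), of 1 1 ?v ?w] card_tight_sets_eq_count[of 2 1 1 x "Suc y" "Suc z"]
    by (simp add: algebra_simps)
  have 2: "card (branch_sets 1 1 1 ?u ?v ?w False True False) = tight_count (Suc x) y (Suc z)"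
    using card_branch_sets_y[OF pos(2), of 1 1 ?u ?w] card_tight_sets_eq_count[of 1 2 1 "Suc x" y "Suc z"]
    by (simp add: algebra_simps)
  have 3: "card (branch_sets 1 1 1 ?u ?v ?w False False True) = tight_count (Suc x) (Suc y) z"
    using card_branch_sets_z[OF pos(3), of 1 1 ?u ?v] card_tight_sets_eq_count[of 1 1 2 "Suc x" "Suc y" z]
    by (simp add: algebra_simps)
  \<comment> \<open>Stated for arbitrary extents, so that cyclic rotation delivers the other two
    pairs of directions.\<close>
  have pair: "card (branch_sets 1 1 1 (1 + int (Suc a)) (1 + int (Suc b)) (1 + int (Suc c)) True True False)
      = tight_count b (Suc c) 0 + tight_count a (Suc c) 0" for a b c
    using card_branch_sets_pair[of 1 "1 + int (Suc a)" 1 "1 + int (Suc b)" 1 "1 + int (Suc c)"]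
      card_tight_sets_eq_count[of 1 2 1 0 b "Suc c"] card_tight_sets_eq_count[of 2 1 1 a 0 "Suc c"]
      tight_count_cycle_xyz[of 0 b "Suc c"] tight_count_cycle_xyz[of "Suc c" a 0] tight_count_swap_xy[of a 0 "Suc c"] tight_count_cycle_xyz[of 0 a "Suc c"]
    by (simp add: algebra_simps)
  have 4: "card (branch_sets 1 1 1 ?u ?v ?w True True False) = tight_count y (Suc z) 0 + tight_count x (Suc z) 0"
    by (rule pair)
  have 5: "card (branch_sets 1 1 1 ?u ?v ?w False True True) = tight_count z (Suc x) 0 + tight_count y (Suc x) 0"
    using card_branch_sets_cycle_xyz[of 1 1 1 ?u ?v ?w False True True] pair[of y z x] by simp
  have 6: "card (branch_sets 1 1 1 ?u ?v ?w True False True) = tight_count x (Suc y) 0 + tight_count z (Suc y) 0"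
    using card_branch_sets_cycle_xyz[of 1 1 1 ?w ?u ?v True True False] pair[of z x y] by simp
  have 7: "card (branch_sets 1 1 1 ?u ?v ?w True True True) = 1"
    using pos by (rule card_branch_sets_triple)
  have 8: "card (branch_sets 1 1 1 ?u ?v ?w False False False) = 0"
    using branch_sets_none pos by simp
  have "tight_count (Suc x) (Suc y) (Suc z) = card (tight_sets 1 1 1 ?u ?v ?w)"
    by (simp only: tight_count_def)
  also have "\<dots> = 1 + (tight_count y (Suc z) 0 + tight_count x (Suc z) 0) + (tight_count x (Suc y) 0 + tight_count z (Suc y) 0)
      + tight_count x (Suc y) (Suc z) + (tight_count z (Suc x) 0 + tight_count y (Suc x) 0) + tight_count (Suc x) y (Suc z)
      + tight_count (Suc x) (Suc y) z + 0"
    by (simp only: card_tight_sets_by_branches 1 2 3 4 5 6 7 8)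
  finally show ?thesis
    using tight_count_swap_xy[of z "Suc x" 0] tight_count_swap_xy[of y "Suc x" 0] tight_count_swap_xy[of z "Suc y" 0] by simp
qed

text \<open>Adding 1 absorbs the constant in \<open>tight_count_flat\<close>, which leaves Pascal's
  rule with boundary value 2.\<close>

lemma tight_count_plane: "tight_count x y 0 + 1 = 2 * ((x + y) choose x)"
proof (induction "x + y" arbitrary: x y)
  case 0
  then show ?case by (simp add: tight_count_line)
next
  case (Suc n)
  show ?case
  proof (cases "x = 0 \<or> y = 0")
    case True
    then show ?thesis using tight_count_line[of x] tight_count_line[of y] tight_count_swap_xy[of 0 y 0] by auto
  next
    case False
    then obtain x' y' where xy: "x = Suc x'" "y = Suc y'" by (metis not0_implies_Suc)
    then have "tight_count x' y 0 + 1 = 2 * ((x' + y) choose x')" "tight_count x y' 0 + 1 = 2 * ((x + y') choose x)"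
      using Suc by auto
    then show ?thesis using tight_count_flat[of x' y'] by (simp add: xy)
  qed
qed

section \<open>Corner-polyominoes as tight sets, and the recursion\<close>

lemma bex_coordinate:
  "(\<exists>(i, j, l)\<in>P. i = a) \<longleftrightarrow> a \<in> xproj P" "(\<exists>(i, j, l)\<in>P. j = a) \<longleftrightarrow> a \<in> yproj P"
  "(\<exists>(i, j, l)\<in>P. l = a) \<longleftrightarrow> a \<in> zproj P"
  by (simp_all add: image_iff case_prod_beta eq_commute)

text \<open>Touching the far faces and being connected to the corner makes each projection a full
  interval. The projection sizes are then the side lengths, and minimal volume is exactly
  tightness.\<close>

lemma p_c_eq_tight_count: "p_c (Suc x) (Suc y) (Suc z) = tight_count x y z"
proof -
  have box: "P \<subseteq> prism (Suc x) (Suc y) (Suc z) \<longleftrightarrow>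
      xproj P \<subseteq> {1..1 + int x} \<and> yproj P \<subseteq> {1..1 + int y} \<and> zproj P \<subseteq> {1..1 + int z}" for P
    unfolding prism_def subset_iff by (auto simp: mem_Times_iff)
  have "corner_polyomino (Suc x) (Suc y) (Suc z) P
      \<longleftrightarrow> P \<in> tight_sets 1 1 1 (1 + int x) (1 + int y) (1 + int z)" (is "?L \<longleftrightarrow> ?R") for P
  proof
    assume ?L
    then have P: "finite P" "connected_cells P" "(1, 1, 1) \<in> P"
      and sub: "P \<subseteq> prism (Suc x) (Suc y) (Suc z)"
      and far: "int (Suc x) \<in> xproj P" "int (Suc y) \<in> yproj P" "int (Suc z) \<in> zproj P"
      and c: "card P = Suc x + Suc y + Suc z - 2"
      unfolding corner_polyomino_def minimal_inscribed_def inscribed_def polyomino_def bex_coordinate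
      by blast+
    have conn_from: "conn_from (1, 1, 1) P" using connected_cells_conn_from P by blast
    have "{1..int (Suc x)} \<subseteq> xproj P" "{1..int (Suc y)} \<subseteq> yproj P" "{1..int (Suc z)} \<subseteq> zproj P"
      using conn_from_interval(1)[OF conn_from far(1)] conn_from_interval(2)[OF conn_from far(2)]
        conn_from_interval(3)[OF conn_from far(3)] by blast+
    then have im: "xproj P = {1..1 + int x}" "yproj P = {1..1 + int y}" "zproj P = {1..1 + int z}"
      using sub unfolding box of_nat_Suc by blast+
    then have "tight (1, 1, 1) P"
      using P conn_from c by (simp add: tight_def)
    then show ?R using im by (simp add: tight_sets_def)
  next
    assume R: ?R
    then have t: "tight (1, 1, 1) P"
      and im: "xproj P = {1..1 + int x}" "yproj P = {1..1 + int y}" "zproj P = {1..1 + int z}"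
      by (simp_all add: tight_sets_def)
    have o: "(1, 1, 1) \<in> P" using R by (rule tight_sets_root)
    have "card P = Suc x + Suc y + Suc z - 2"
      using t im by (simp add: tight_def nat_add_distrib)
    moreover have "polyomino P"
      using t o connected_cells_conn_from[OF o] unfolding polyomino_def tight_def by blast
    ultimately show ?L
      using o unfolding corner_polyomino_def minimal_inscribed_def inscribed_def bex_coordinate box im
      by simp
  qed
  then show ?thesis by (simp add: p_c_def tight_count_def)
qed

lemma trinomial_zero:
  "trinomial 0 x y = (x + y) choose x" "trinomial x 0 y = (x + y) choose x"
  "trinomial x y 0 = (x + y) choose x"
  using binomial_fact'[of x "x + y"] by (simp_all add: trinomial_def)

theorem theorem1:
  fixes b k h :: nat
  assumes "b \<ge> 1" and "k \<ge> 1" and "h \<ge> 1"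
  shows "int (p_c b k h) =
    (if b = 1 \<or> k = 1 \<or> h = 1
     then 2 * int (trinomial (b - 1) (k - 1) (h - 1)) - 1
     else 1 + 2 * int ((b + k - 2) choose (b - 1))
            + 2 * int ((b + h - 2) choose (b - 1))
            + 2 * int ((k + h - 2) choose (k - 1)) - 6
            + int (p_c (b - 1) k h) + int (p_c b (k - 1) h) + int (p_c b k (h - 1)))"
proof -
  obtain x y z where s: "b = Suc x" "k = Suc y" "h = Suc z"
    using assms by (metis One_nat_def Suc_le_D)
  show ?thesis
  proof (cases "b = 1 \<or> k = 1 \<or> h = 1")
    case True
    \<comment> \<open>A side of length one is an extent of zero; symmetry moves it into the last
      position, where the planar formula applies.\<close>
    then have "tight_count x y z + 1 = 2 * trinomial x y z"
      using tight_count_plane[of y z] tight_count_plane[of x z] tight_count_plane[of x y] tight_count_cycle_xyz[of 0 y z] tight_count_swap_xy[of x 0 z] tight_count_cycle_xyz[of 0 x z]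
      by (auto simp: s trinomial_zero)
    then have "int (tight_count x y z) = 2 * int (trinomial x y z) - 1" by linarith
    then show ?thesis using True by (simp add: s p_c_eq_tight_count)
  next
    case False
    then obtain x' y' z' where t: "x = Suc x'" "y = Suc y'" "z = Suc z'"
      unfolding s by (metis One_nat_def not0_implies_Suc)
    \<comment> \<open>By \<open>tight_count_flat\<close> and \<open>tight_count_plane\<close>, each
      pair of planar counts is twice a binomial coefficient minus 2. The three pairs together
      produce the \<open>- 6\<close>, and the tripod the leading 1.\<close>
    have "tight_count x' y 0 + tight_count x y' 0 + 2 = 2 * ((x + y) choose x)"
      "tight_count x' z 0 + tight_count x z' 0 + 2 = 2 * ((x + z) choose x)"
      "tight_count y' z 0 + tight_count y z' 0 + 2 = 2 * ((y + z) choose y)"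
      using tight_count_plane[of x y] tight_count_plane[of x z] tight_count_plane[of y z]
        tight_count_flat[of x' y'] tight_count_flat[of x' z'] tight_count_flat[of y' z'] by (simp_all only: t)
    moreover have "tight_count x y z = tight_count x' y z + tight_count x y' z + tight_count x y z' + (tight_count x' z 0 + tight_count x z' 0)
        + (tight_count x' y 0 + tight_count x y' 0) + (tight_count y' z 0 + tight_count y z' 0) + 1"
      unfolding t by (rule tight_count_solid)
    ultimately have "int (tight_count x y z) = 1 + 2 * int ((x + y) choose x) + 2 * int ((x + z) choose x)
        + 2 * int ((y + z) choose y) - 6 + int (tight_count x' y z) + int (tight_count x y' z) + int (tight_count x y z')"
      by linarith
    moreover have "p_c (b - 1) k h = tight_count x' y z" "p_c b (k - 1) h = tight_count x y' z" "p_c b k (h - 1) = tight_count x y z'"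
      "p_c b k h = tight_count x y z"
      by (simp_all only: s t diff_Suc_1 p_c_eq_tight_count)
    moreover have "b + k - 2 = x + y" "b + h - 2 = x + z" "k + h - 2 = y + z" "b - 1 = x" "k - 1 = y"
      by (simp_all add: s)
    ultimately show ?thesis using False by simp
  qed
qed

end
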